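(* For the multiple-choice secretary problem with regret minimization as the objective, there exists an algorithm whose worst-case regret is $O(\sqrt{k})$.
   Context: Multiple-choice secretary problem: $n$ adversarially chosen values in $[0,1]$ arrive in a uniformly random order; an online algorithm must irrevocably decide upon each arrival whether to select it, and may select at most $k$ values. The regret on an instance is the sum of the $k$ largest values minus the expected sum of the selected values; the worst-case regret is the supremum over all $n$ and all instances. *)

theory Defs
  imports "HOL-Probability.Probability" "HOL-Combinatorics.Permutations"
begin

text \<open>
  A deterministic online policy maps the values observed so far, in order of arrival and
  with the current value last, to the decision whether to select the current value. Earlier
  decisions need not be an argument: they are determined by the earlier prefixes.
\<close>

type_synonym policy = "real list \<Rightarrow> bool"

definition selected :: "policy \<Rightarrow> real list \<Rightarrow> nat set" where
  "selected d xs = {i. i < length xs \<and> d (take (Suc i) xs)}"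

definition gain :: "policy \<Rightarrow> real list \<Rightarrow> real" where
  "gain d xs = (\<Sum>i\<in>selected d xs. xs ! i)"

definition instances :: "nat \<Rightarrow> real list set" where
  "instances n = {v. length v = n \<and> set v \<subseteq> {0..1}}"

definition feasible :: "nat \<Rightarrow> nat \<Rightarrow> policy \<Rightarrow> bool" where
  "feasible k n d \<longleftrightarrow> (\<forall>xs\<in>instances n. card (selected d xs) \<le> k)"

text \<open>
  A randomized online algorithm with capacity \<open>k\<close> for \<open>n\<close> arrivals is a probability
  distribution over feasible deterministic policies (point masses give the deterministic
  algorithms). The \<open>\<sigma>\<close>-algebra is arbitrary, provided each single decision is an event.
\<close>

definition online_algorithm :: "nat \<Rightarrow> nat \<Rightarrow> policy measure \<Rightarrow> bool" where
  "online_algorithm k n M \<longleftrightarrow>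
     prob_space M \<and>
     (\<forall>h. (\<lambda>d. d h) \<in> measurable M (count_space UNIV)) \<and>
     (\<forall>d\<in>space M. feasible k n d)"

text \<open>
  The arrival order is uniform over all permutations of the \<open>length v\<close> positions and
  independent of the internal randomness of the algorithm.
\<close>

definition expected_gain :: "policy measure \<Rightarrow> real list \<Rightarrow> real" where
  "expected_gain M v =
     measure_pmf.expectation (pmf_of_set {\<sigma>. \<sigma> permutes {..<length v}})
       (\<lambda>\<sigma>. LINT d|M. gain d (permute_list \<sigma> v))"

text \<open>If there are fewer than \<open>k\<close> values, the benchmark is the sum of all of them.\<close>

definition top_sum :: "nat \<Rightarrow> real list \<Rightarrow> real" where
  "top_sum k v = sum_list (take k (rev (sort v)))"

definition regret :: "nat \<Rightarrow> policy measure \<Rightarrow> real list \<Rightarrow> real" where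
  "regret k M v = top_sum k v - expected_gain M v"

text \<open>
  The capacity and the number of arrivals are known in advance: \<open>A n\<close> is the algorithm that
  is run on instances with \<open>n\<close> values. The supremum is taken in the extended reals, so
  it exists without any boundedness argument.
\<close>

definition worst_case_regret :: "nat \<Rightarrow> (nat \<Rightarrow> policy measure) \<Rightarrow> ereal" where
  "worst_case_regret k A = (SUP n. SUP v\<in>instances n. ereal (regret k (A n) v))"

end

theory Submission
  imports Defs
begin

text \<open>
  Let \<open>K = min k n\<close> and break ties by uniformly random labels. Call the arrival at time \<open>t\<close>
  (counted from 1) a candidate if it is among the \<open>\<lfloor>K t / n\<rfloor>\<close> best arrivals so far, and
  select the first \<open>K\<close> candidates. Conditionally on the set of the first \<open>t\<close> items, the item
  at time \<open>t\<close> is uniform in it, so the expected value collected from candidates at time \<open>t\<close> is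
  \<open>1/t\<close> times the expected sum of the \<open>\<lfloor>K t / n\<rfloor>\<close> largest of these items. The number of
  the overall top \<open>K\<close> items among them has mean \<open>\<mu> = K t / n\<close> and variance at most \<open>\<mu>\<close>, so this is
  at least the fraction \<open>1/n\<close> of the benchmark, up to an error \<open>2 sqrt \<mu> / t\<close>; these errors add up
  to at most \<open>4 sqrt K\<close>. The events of being a candidate are independent with total
  probability at most \<open>K\<close>, so the number of candidates exceeds \<open>K\<close> by at most \<open>sqrt K\<close> in
  expectation. Hence the regret is at most \<open>5 sqrt K\<close>.
\<close>

subsection \<open>Ranks in finite strict linear orders\<close>

definition below :: "('a \<Rightarrow> 'a \<Rightarrow> bool) \<Rightarrow> 'a set \<Rightarrow> 'a \<Rightarrow> 'a set" where
  "below R T u = {s\<in>T. R s u}"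

text \<open>Counting predecessors is strictly increasing along \<open>R\<close>, hence injective by
  totality; no element counts itself, so the counts fill \<open>{..<card T}\<close>. The order stays
  abstract because it serves for overall ranks, tie-broken values and arrival times.\<close>

lemma bij_betw_card_below:
  assumes "finite T"
    and irr: "\<And>x. x \<in> T \<Longrightarrow> \<not> R x x"
    and tr: "\<And>x y z. x \<in> T \<Longrightarrow> y \<in> T \<Longrightarrow> z \<in> T \<Longrightarrow> R x y \<Longrightarrow> R y z \<Longrightarrow> R x z"
    and tot: "\<And>x y. x \<in> T \<Longrightarrow> y \<in> T \<Longrightarrow> x \<noteq> y \<Longrightarrow> R x y \<or> R y x"
  shows "bij_betw (\<lambda>u. card (below R T u)) T {..<card T}"
    and "\<And>x y. x \<in> T \<Longrightarrow> y \<in> T \<Longrightarrow> card (below R T x) < card (below R T y) \<longleftrightarrow> R x y"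
proof -
  let ?g = "\<lambda>u. card (below R T u)"
  have fin: "finite (below R T u)" for u
    using \<open>finite T\<close> by (simp add: below_def)
  have mono: "?g x < ?g y" if "x \<in> T" "y \<in> T" "R x y" for x y
  proof (rule psubset_card_mono[OF fin])
    have "below R T x \<subseteq> below R T y"
      using tr[OF _ that(1,2) _ that(3)] by (auto simp: below_def)
    moreover have "x \<in> below R T y" "x \<notin> below R T x"
      using that irr[of x] by (simp_all add: below_def)
    ultimately show "below R T x \<subset> below R T y" by blast
  qed
  show "?g x < ?g y \<longleftrightarrow> R x y" if "x \<in> T" "y \<in> T" for x y
  proof (cases "x = y")
    case False
    then show ?thesis using mono[OF that] mono[OF that(2,1)] tot[OF that] by linarith
  qed (use irr[OF that(1)] in simp)
  have inj: "inj_on ?g T"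
  proof (rule inj_onI, rule ccontr)
    fix x y assume xy: "x \<in> T" "y \<in> T" "?g x = ?g y" "x \<noteq> y"
    then show False using mono[OF xy(1,2)] mono[OF xy(2,1)] tot[OF xy(1,2,4)] by linarith
  qed
  have "?g u < card T" if "u \<in> T" for u
    by (rule psubset_card_mono) (use that irr[OF that] \<open>finite T\<close> in \<open>auto simp: below_def\<close>)
  then have "?g ` T \<subseteq> {..<card T}" by auto
  then show "bij_betw ?g T {..<card T}"
    using inj by (simp add: bij_betw_def card_image card_subset_eq)
qed

lemma card_low_rank:
  assumes "finite T"
    and "\<And>x. x \<in> T \<Longrightarrow> \<not> R x x"
    and "\<And>x y z. x \<in> T \<Longrightarrow> y \<in> T \<Longrightarrow> z \<in> T \<Longrightarrow> R x y \<Longrightarrow> R y z \<Longrightarrow> R x z"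
    and "\<And>x y. x \<in> T \<Longrightarrow> y \<in> T \<Longrightarrow> x \<noteq> y \<Longrightarrow> R x y \<or> R y x"
  shows "card {u\<in>T. card (below R T u) < j} = min j (card T)"
proof -
  let ?g = "\<lambda>u. card (below R T u)"
  have bij: "bij_betw ?g T {..<card T}"
    by (rule bij_betw_card_below(1)[OF assms])
  have "?g ` {u\<in>T. ?g u < j} = {..<card T} \<inter> {..<j}"
    using bij by (auto simp: bij_betw_def)
  moreover have "inj_on ?g {u\<in>T. ?g u < j}"
    using bij by (auto simp: bij_betw_def inj_on_def)
  ultimately have "card {u\<in>T. ?g u < j} = card ({..<card T} \<inter> {..<j})"
    using card_image[of ?g "{u\<in>T. ?g u < j}"] by simp
  also have "{..<card T} \<inter> {..<j} = {..<min j (card T)}" by auto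
  finally show ?thesis by simp
qed

subsection \<open>Averages over uniformly random permutations\<close>

text \<open>A plain finite sum keeps linearity, exchange of averages and reindexing by composition
  elementary; \<open>integral_permutations\<close> connects it with the expectation.\<close>

definition perm_avg :: "nat \<Rightarrow> ((nat \<Rightarrow> nat) \<Rightarrow> real) \<Rightarrow> real" where
  "perm_avg n f = (\<Sum>\<pi> | \<pi> permutes {..<n}. f \<pi>) / fact n"

lemma perm_avg_add: "perm_avg n (\<lambda>\<pi>. f \<pi> + g \<pi>) = perm_avg n f + perm_avg n g"
  by (simp add: perm_avg_def sum.distrib add_divide_distrib)

lemma perm_avg_diff: "perm_avg n (\<lambda>\<pi>. f \<pi> - g \<pi>) = perm_avg n f - perm_avg n g"
  by (simp add: perm_avg_def sum_subtractf diff_divide_distrib)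

lemma perm_avg_cmult: "perm_avg n (\<lambda>\<pi>. c * f \<pi>) = c * perm_avg n f"
  by (simp add: perm_avg_def sum_distrib_left)

lemma perm_avg_const: "perm_avg n (\<lambda>\<pi>. c) = c"
  by (simp add: perm_avg_def card_permutations)

lemma perm_avg_sum: "perm_avg n (\<lambda>\<pi>. \<Sum>u\<in>U. f u \<pi>) = (\<Sum>u\<in>U. perm_avg n (f u))"
  unfolding perm_avg_def by (subst sum.swap) (simp add: sum_divide_distrib)

lemma perm_avg_mono:
  assumes "\<And>\<pi>. \<pi> permutes {..<n} \<Longrightarrow> f \<pi> \<le> g \<pi>"
  shows "perm_avg n f \<le> perm_avg n g"
  unfolding perm_avg_def using assms by (intro divide_right_mono sum_mono) auto

lemma perm_avg_cong:
  assumes "\<And>\<pi>. \<pi> permutes {..<n} \<Longrightarrow> f \<pi> = g \<pi>"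
  shows "perm_avg n f = perm_avg n g"
  unfolding perm_avg_def by (intro arg_cong2[where f = "(/)"] sum.cong) (use assms in auto)

lemma perm_avg_compose_right:
  assumes "q permutes {..<n}"
  shows "perm_avg n (\<lambda>\<pi>. f (\<pi> \<circ> q)) = perm_avg n f"
  unfolding perm_avg_def using sum_permutations_compose_right[OF assms, of f] by simp

lemma perm_avg_compose_left:
  assumes "q permutes {..<n}"
  shows "perm_avg n (\<lambda>\<pi>. f (q \<circ> \<pi>)) = perm_avg n f"
  unfolding perm_avg_def using setum_permutations_compose_left[OF assms, of f] by simp

lemma perm_avg_swap:
  assumes "a < n" "b < n"
  shows "perm_avg n (\<lambda>\<pi>. f (\<pi> \<circ> Transposition.transpose a b)) = perm_avg n f"
  using assms by (intro perm_avg_compose_right permutes_swap_id) auto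

text \<open>Exchanging positions \<open>t\<close> and \<open>u\<close> preserves the uniform
  distribution. Averaging over all \<open>u \<le> t\<close> stands in for conditioning on the set of
  the first \<open>t + 1\<close> items.\<close>

lemma perm_avg_prefix:
  assumes "t < n"
  shows "perm_avg n f = perm_avg n (\<lambda>\<pi>. \<Sum>u\<le>t. f (\<pi> \<circ> Transposition.transpose t u)) / (real t + 1)"
proof -
  have "perm_avg n (\<lambda>\<pi>. \<Sum>u\<le>t. f (\<pi> \<circ> Transposition.transpose t u))
      = (\<Sum>u\<le>t. perm_avg n (\<lambda>\<pi>. f (\<pi> \<circ> Transposition.transpose t u)))"
    by (rule perm_avg_sum)
  also have "\<dots> = (\<Sum>u\<le>t. perm_avg n f)"
    using assms by (intro sum.cong perm_avg_swap) auto
  finally show ?thesis by (simp add: field_simps)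
qed

section \<open>Marginals, correlations and deviations under a random permutation\<close>

lemma perm_avg_point:
  assumes "u < n"
  shows "perm_avg n (\<lambda>\<pi>. f (\<pi> u)) = (\<Sum>i<n. f i) / n"
proof -
  have "(\<Sum>i<n. f i) = perm_avg n (\<lambda>\<pi>. \<Sum>x<n. f (\<pi> x))"
  proof -
    have "perm_avg n (\<lambda>\<pi>. \<Sum>x<n. f (\<pi> x)) = perm_avg n (\<lambda>\<pi>. \<Sum>i<n. f i)"
      by (intro perm_avg_cong) (simp add: sum.permute[unfolded o_def, symmetric])
    then show ?thesis by (simp add: perm_avg_const)
  qed
  also have "\<dots> = (\<Sum>x<n. perm_avg n (\<lambda>\<pi>. f (\<pi> x)))"
    by (rule perm_avg_sum)
  \<comment> \<open>Transposing \<open>x\<close> and \<open>u\<close> shows that every position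
    carries the same share of the total.\<close>
  also have "\<dots> = (\<Sum>x<n. perm_avg n (\<lambda>\<pi>. f (\<pi> u)))"
  proof (intro sum.cong refl)
    fix x assume "x \<in> {..<n}"
    then show "perm_avg n (\<lambda>\<pi>. f (\<pi> x)) = perm_avg n (\<lambda>\<pi>. f (\<pi> u))"
      using perm_avg_swap[of x n u "\<lambda>\<pi>. f (\<pi> u)"] assms by simp
  qed
  finally show ?thesis using assms by simp
qed

text \<open>This is sampling without replacement: the pair probability is
  \<open>(K - 1) / (n - 1) * (K / n)\<close>, and its first factor is at most \<open>K / n\<close>
  because \<open>K \<le> n\<close>.\<close>

lemma perm_avg_pair:
  assumes "u < n" "u' < n" "u \<noteq> u'" "K \<le> n"
  shows "perm_avg n (\<lambda>\<pi>. of_bool (\<pi> u < K) * of_bool (\<pi> u' < K)) \<le> (K / n) * (K / n)"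
proof -
  let ?a = "\<lambda>x \<pi>. of_bool (\<pi> x < K) :: real"
  let ?S = "{..<n} - {u}"
  have p: "perm_avg n (?a u) = K / n"
  proof -
    have "(\<Sum>i<n. of_bool (i < K) :: real) = card ({..<n} \<inter> {i. i < K})"
      by (simp add: of_bool_def sum.If_cases)
    also have "{..<n} \<inter> {i. i < K} = {..<K}" using assms by auto
    finally show ?thesis
      using perm_avg_point[OF assms(1), of "\<lambda>i. of_bool (i < K)"] by simp
  qed
  have cnt: "(\<Sum>x\<in>?S. ?a x \<pi>) = K - ?a u \<pi>" if "\<pi> permutes {..<n}" for \<pi>
  proof -
    have "(\<Sum>x<n. ?a x \<pi>) = (\<Sum>i<n. of_bool (i < K))"
      using sum.permute[OF that, of "\<lambda>i. of_bool (i < K) :: real"] by (simp add: o_def)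
    also have "\<dots> = card ({..<n} \<inter> {i. i < K})"
      by (simp add: of_bool_def sum.If_cases)
    also have "{..<n} \<inter> {i. i < K} = {..<K}" using assms by auto
    finally have "(\<Sum>x<n. ?a x \<pi>) = real K" by simp
    moreover have "(\<Sum>x<n. ?a x \<pi>) = ?a u \<pi> + (\<Sum>x\<in>?S. ?a x \<pi>)"
      using assms(1) by (intro sum.remove) auto
    ultimately show ?thesis by linarith
  qed
  \<comment> \<open>All \<open>n - 1\<close> partners \<open>x\<close> of \<open>u\<close> give the
    same average, so it is recovered from their sum, where \<open>cnt\<close> applies: exactly
    \<open>K\<close> positions carry values below \<open>K\<close>.\<close>
  have "(real n - 1) * perm_avg n (\<lambda>\<pi>. ?a u \<pi> * ?a u' \<pi>)
      = (\<Sum>x\<in>?S. perm_avg n (\<lambda>\<pi>. ?a u \<pi> * ?a u' \<pi>))"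
    using assms by (simp add: of_nat_diff)
  also have "\<dots> = (\<Sum>x\<in>?S. perm_avg n (\<lambda>\<pi>. ?a u \<pi> * ?a x \<pi>))"
  proof (intro sum.cong refl)
    fix x assume "x \<in> ?S"
    then show "perm_avg n (\<lambda>\<pi>. ?a u \<pi> * ?a u' \<pi>) = perm_avg n (\<lambda>\<pi>. ?a u \<pi> * ?a x \<pi>)"
      using perm_avg_swap[of u' n x "\<lambda>\<pi>. ?a u \<pi> * ?a x \<pi>"] assms by (simp add: transpose_def)
  qed
  also have "\<dots> = perm_avg n (\<lambda>\<pi>. \<Sum>x\<in>?S. ?a u \<pi> * ?a x \<pi>)"
    by (rule perm_avg_sum[symmetric])
  also have "\<dots> = perm_avg n (\<lambda>\<pi>. (real K - 1) * ?a u \<pi>)"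
  proof (rule perm_avg_cong)
    fix \<pi> :: "nat \<Rightarrow> nat" assume "\<pi> permutes {..<n}"
    then have "(\<Sum>x\<in>?S. ?a u \<pi> * ?a x \<pi>) = ?a u \<pi> * (K - ?a u \<pi>)"
      by (simp only: cnt flip: sum_distrib_left)
    also have "\<dots> = (real K - 1) * ?a u \<pi>" by (cases "\<pi> u < K") auto
    finally show "(\<Sum>x\<in>?S. ?a u \<pi> * ?a x \<pi>) = (real K - 1) * ?a u \<pi>" .
  qed
  also have "\<dots> = (real K - 1) * (K / n)"
    by (simp only: perm_avg_cmult p)
  finally have eq: "(real n - 1) * perm_avg n (\<lambda>\<pi>. ?a u \<pi> * ?a u' \<pi>) = (real K - 1) * (K / n)" .
  have "n > 1" using assms by auto
  then have "perm_avg n (\<lambda>\<pi>. ?a u \<pi> * ?a u' \<pi>) = (real K - 1) / (real n - 1) * (K / n)"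
    using eq by (simp add: field_simps)
  also have "\<dots> \<le> K / n * (K / n)"
    using \<open>n > 1\<close> \<open>K \<le> n\<close> by (intro mult_right_mono) (auto simp: field_simps)
  finally show ?thesis .
qed

text \<open>
  Pairwise non-positive correlation bounds the variance by the mean; AM-GM then replaces
  Cauchy-Schwarz.
\<close>

lemma perm_avg_excess:
  fixes p :: "'i \<Rightarrow> real" and a :: "'i \<Rightarrow> (nat \<Rightarrow> nat) \<Rightarrow> bool"
  assumes "finite U"
    and mean: "\<And>u. u \<in> U \<Longrightarrow> perm_avg n (\<lambda>\<pi>. of_bool (a u \<pi>)) = p u"
    and pair: "\<And>u u'. u \<in> U \<Longrightarrow> u' \<in> U \<Longrightarrow> u \<noteq> u' \<Longrightarrow>
      perm_avg n (\<lambda>\<pi>. of_bool (a u \<pi>) * of_bool (a u' \<pi>)) \<le> p u * p u'"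
    and m: "(\<Sum>u\<in>U. p u) \<le> m" "0 < m"
  shows "perm_avg n (\<lambda>\<pi>. max 0 ((\<Sum>u\<in>U. of_bool (a u \<pi>)) - m)) \<le> sqrt m"
proof -
  let ?b = "\<lambda>u \<pi>. of_bool (a u \<pi>) - p u"
  have cov: "perm_avg n (\<lambda>\<pi>. ?b u \<pi> * ?b u' \<pi>) \<le> (if u = u' then p u else 0)"
    if "u \<in> U" "u' \<in> U" for u u'
  proof -
    have "perm_avg n (\<lambda>\<pi>. ?b u \<pi> * ?b u' \<pi>)
        = perm_avg n (\<lambda>\<pi>. of_bool (a u \<pi>) * of_bool (a u' \<pi>) - p u' * of_bool (a u \<pi>)
            - p u * of_bool (a u' \<pi>) + p u * p u')"
      by (intro perm_avg_cong) (simp add: algebra_simps)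
    also have "\<dots> = perm_avg n (\<lambda>\<pi>. of_bool (a u \<pi>) * of_bool (a u' \<pi>)) - p u * p u'"
      using that by (simp add: perm_avg_add perm_avg_diff perm_avg_cmult perm_avg_const mean)
    finally have eq: "perm_avg n (\<lambda>\<pi>. ?b u \<pi> * ?b u' \<pi>)
      = perm_avg n (\<lambda>\<pi>. of_bool (a u \<pi>) * of_bool (a u' \<pi>)) - p u * p u'" .
    show ?thesis
    proof (cases "u = u'")
      case True
      have "perm_avg n (\<lambda>\<pi>. of_bool (a u \<pi>) * of_bool (a u \<pi>)) = p u"
        using mean[OF that(1)] by (simp flip: of_bool_conj)
      then show ?thesis using eq True by simp
    qed (use eq pair[OF that] in simp)
  qed
  let ?X = "\<lambda>\<pi>. \<Sum>u\<in>U. of_bool (a u \<pi>) :: real"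
  let ?M = "\<Sum>u\<in>U. p u"
  have "perm_avg n (\<lambda>\<pi>. (?X \<pi> - ?M)\<^sup>2)
      = perm_avg n (\<lambda>\<pi>. \<Sum>u\<in>U. \<Sum>u'\<in>U. ?b u \<pi> * ?b u' \<pi>)"
    by (intro perm_avg_cong) (simp add: power2_eq_square sum_product flip: sum_subtractf)
  also have "\<dots> = (\<Sum>u\<in>U. \<Sum>u'\<in>U. perm_avg n (\<lambda>\<pi>. ?b u \<pi> * ?b u' \<pi>))"
    by (simp only: perm_avg_sum)
  also have "\<dots> \<le> (\<Sum>u\<in>U. \<Sum>u'\<in>U. if u = u' then p u else 0)"
    by (intro sum_mono cov)
  also have "\<dots> = ?M" using \<open>finite U\<close> by simp
  finally have var: "perm_avg n (\<lambda>\<pi>. (?X \<pi> - ?M)\<^sup>2) \<le> m" using m by simp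
  \<comment> \<open>For \<open>c > 0\<close>, \<open>x\<close> is at most
    \<open>x * x / (2 * c) + c / 2\<close>. With variance at most \<open>m\<close>, the choice
    \<open>sqrt m\<close> bounds the average of each summand by \<open>sqrt m / 2\<close>.\<close>
  define c where "c = sqrt m"
  have c: "c > 0" "c * c = m" using m by (auto simp: c_def)
  have "perm_avg n (\<lambda>\<pi>. max 0 (?X \<pi> - m))
      \<le> perm_avg n (\<lambda>\<pi>. 1 / (2 * c) * (?X \<pi> - ?M)\<^sup>2 + c / 2)"
  proof (rule perm_avg_mono)
    fix \<pi>
    have "0 \<le> (?X \<pi> - ?M - c)\<^sup>2" by simp
    then have "2 * c * (?X \<pi> - ?M) \<le> (?X \<pi> - ?M)\<^sup>2 + c * c"
      by (simp add: power2_eq_square algebra_simps)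
    then have "?X \<pi> - ?M \<le> 1 / (2 * c) * (?X \<pi> - ?M)\<^sup>2 + c / 2"
      using c(1) by (simp add: field_simps)
    moreover have "0 \<le> 1 / (2 * c) * (?X \<pi> - ?M)\<^sup>2 + c / 2" using c(1) by simp
    ultimately show "max 0 (?X \<pi> - m) \<le> 1 / (2 * c) * (?X \<pi> - ?M)\<^sup>2 + c / 2"
      using m by simp
  qed
  also have "\<dots> = 1 / (2 * c) * perm_avg n (\<lambda>\<pi>. (?X \<pi> - ?M)\<^sup>2) + c / 2"
    by (simp only: perm_avg_add perm_avg_cmult perm_avg_const)
  also have "\<dots> \<le> 1 / (2 * c) * m + c / 2"
    using var c(1) by (intro add_right_mono mult_left_mono) auto
  also have "\<dots> = c" using c by (simp add: field_simps)
  finally show ?thesis by (simp add: c_def)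
qed

subsection \<open>Selection by relative rank\<close>

text \<open>Here \<open>\<pi> u\<close> is the overall rank of the item arriving at time
  \<open>u\<close>, with 0 the best. Every \<open>u\<close> in the prefix gets a rank, not only the
  last arrival, so that positions can be exchanged.\<close>

definition prefix_rank :: "(nat \<Rightarrow> nat) \<Rightarrow> nat \<Rightarrow> nat \<Rightarrow> nat" where
  "prefix_rank \<pi> t u = card (below (\<lambda>x y. \<pi> x < \<pi> y) {..t} u)"

text \<open>There are two uses: transposing \<open>t\<close> and \<open>u\<close> turns the rank of
  the last arrival into that of \<open>u\<close>, while a rearrangement fixing \<open>t\<close>
  leaves the rank of the last arrival unchanged.\<close>

lemma prefix_rank_compose:
  assumes "q permutes {..t}"
  shows "prefix_rank (\<pi> \<circ> q) t u = prefix_rank \<pi> t (q u)"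
proof -
  have "below (\<lambda>x y. \<pi> x < \<pi> y) {..t} (q u) = q ` below (\<lambda>x y. (\<pi> \<circ> q) x < (\<pi> \<circ> q) y) {..t} u"
    using permutes_image[OF assms] by (auto simp: below_def)
  then show ?thesis
    unfolding prefix_rank_def using card_image[OF permutes_inj_on[OF assms]] by metis
qed

lemma card_prefix_rank_less:
  assumes "inj \<pi>"
  shows "card {u\<in>{..t}. prefix_rank \<pi> t u < j} = min j (Suc t)"
proof -
  have "\<pi> x < \<pi> y \<or> \<pi> y < \<pi> x" if "x \<noteq> y" for x y
    using injD[OF assms, of x y] that by linarith
  then have "card {u\<in>{..t}. prefix_rank \<pi> t u < j} = min j (card {..t})"
    unfolding prefix_rank_def by (intro card_low_rank) simp_all
  then show ?thesis by simp
qed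

lemma sum_of_bool_times:
  fixes f :: "'i \<Rightarrow> real"
  assumes "finite U"
  shows "(\<Sum>u\<in>U. of_bool (P u) * f u) = sum f {u\<in>U. P u}"
  unfolding sum.inter_filter[OF assms] by (intro sum.cong) auto

lemma sum_of_bool_card:
  assumes "finite U"
  shows "(\<Sum>u\<in>U. of_bool (P u) :: real) = card {u\<in>U. P u}"
  using sum_of_bool_times[OF assms, of P "\<lambda>_. 1"] by simp

text \<open>
  With \<open>f\<close> the indicator of an event about the rank at a later time, which ignores the order of
  the first \<open>s + 1\<close> arrivals, this is the independence of relative ranks.
\<close>

lemma perm_avg_prefix_rank:
  assumes "s < n"
    and inv: "\<And>\<pi> u. u \<le> s \<Longrightarrow> f (\<pi> \<circ> Transposition.transpose s u) = f \<pi>"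
  shows "perm_avg n (\<lambda>\<pi>. of_bool (prefix_rank \<pi> s s < j) * f \<pi>)
    = real (min j (Suc s)) / (real s + 1) * perm_avg n f"
proof -
  have "perm_avg n (\<lambda>\<pi>. of_bool (prefix_rank \<pi> s s < j) * f \<pi>)
      = perm_avg n (\<lambda>\<pi>. \<Sum>u\<le>s. of_bool (prefix_rank (\<pi> \<circ> Transposition.transpose s u) s s < j)
          * f (\<pi> \<circ> Transposition.transpose s u)) / (real s + 1)"
    by (rule perm_avg_prefix[OF assms(1)])
  also have "\<dots> = perm_avg n (\<lambda>\<pi>. real (min j (Suc s)) * f \<pi>) / (real s + 1)"
  proof (intro arg_cong2[where f = "(/)"] perm_avg_cong refl)
    fix \<pi> :: "nat \<Rightarrow> nat" assume \<pi>: "\<pi> permutes {..<n}"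
    have "(\<Sum>u\<le>s. of_bool (prefix_rank (\<pi> \<circ> Transposition.transpose s u) s s < j)
          * f (\<pi> \<circ> Transposition.transpose s u))
        = (\<Sum>u\<le>s. of_bool (prefix_rank \<pi> s u < j) * f \<pi>)"
      by (intro sum.cong) (simp_all add: inv prefix_rank_compose permutes_swap_id)
    also have "\<dots> = real (card {u\<in>{..s}. prefix_rank \<pi> s u < j}) * f \<pi>"
      by (simp only: sum_distrib_right[symmetric] sum_of_bool_card[OF finite_atMost])
    also have "\<dots> = real (min j (Suc s)) * f \<pi>"
      by (simp only: card_prefix_rank_less[OF permutes_inj[OF \<pi>]])
    finally show "(\<Sum>u\<le>s. of_bool (prefix_rank (\<pi> \<circ> Transposition.transpose s u) s s < j)
          * f (\<pi> \<circ> Transposition.transpose s u)) = real (min j (Suc s)) * f \<pi>" .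
  qed
  finally show ?thesis by (simp only: perm_avg_cmult times_divide_eq_left)
qed

text \<open>Within the prefix, the \<open>j\<close> lowest ranks and the items of overall rank below
  \<open>K\<close> are initial segments of the same order, so one contains the other. Either nothing
  is lost, or the missing items cost at most 1 each.\<close>

lemma sum_low_ranks_ge:
  fixes w :: "nat \<Rightarrow> real"
  assumes "inj \<pi>" "j \<le> Suc t" and w: "\<And>u. u \<le> t \<Longrightarrow> 0 \<le> w (\<pi> u) \<and> w (\<pi> u) \<le> 1"
  shows "(\<Sum>u\<le>t. of_bool (\<pi> u < K) * w (\<pi> u)) - max 0 ((\<Sum>u\<le>t. of_bool (\<pi> u < K)) - real j)
    \<le> (\<Sum>u\<le>t. of_bool (prefix_rank \<pi> t u < j) * w (\<pi> u))"
proof -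
  define A where "A = {u\<in>{..t}. prefix_rank \<pi> t u < j}"
  define B where "B = {u\<in>{..t}. \<pi> u < K}"
  have fin: "finite A" "finite B" by (simp_all add: A_def B_def)
  have cA: "card A = j"
    using card_prefix_rank_less[OF assms(1), of t j] assms(2) by (simp add: A_def)
  have "(\<Sum>u\<in>B. w (\<pi> u)) - max 0 (real (card B) - real j) \<le> (\<Sum>u\<in>A. w (\<pi> u))"
  proof (cases "card B \<le> j")
    case True
    have "B \<subseteq> A"
    proof
      fix u assume u: "u \<in> B"
      have "below (\<lambda>x y. \<pi> x < \<pi> y) {..t} u \<subseteq> B - {u}"
        using u by (auto simp: below_def B_def)
      then have "prefix_rank \<pi> t u \<le> card (B - {u})"
        unfolding prefix_rank_def using fin by (intro card_mono) auto
      also have "\<dots> < card B" using u fin by (meson card_Diff1_less)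
      finally show "u \<in> A" using True u by (simp add: A_def B_def)
    qed
    then have "(\<Sum>u\<in>B. w (\<pi> u)) \<le> (\<Sum>u\<in>A. w (\<pi> u))"
      using fin w by (intro sum_mono2) (auto simp: A_def)
    then show ?thesis by simp
  next
    case False
    have AB: "A \<subseteq> B"
    proof (rule subsetI, rule ccontr)
      fix u assume u: "u \<in> A" "u \<notin> B"
      then have "B \<subseteq> below (\<lambda>x y. \<pi> x < \<pi> y) {..t} u"
        by (auto simp: below_def A_def B_def)
      then have "card B \<le> prefix_rank \<pi> t u"
        unfolding prefix_rank_def by (intro card_mono) (auto simp: below_def)
      then show False using u False by (simp add: A_def)
    qed
    have "(\<Sum>u\<in>B. w (\<pi> u)) = (\<Sum>u\<in>A. w (\<pi> u)) + (\<Sum>u\<in>B - A. w (\<pi> u))"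
      using sum.subset_diff[OF AB fin(2), of "\<lambda>u. w (\<pi> u)"] by simp
    also have "(\<Sum>u\<in>B - A. w (\<pi> u)) \<le> real (card (B - A))"
      using sum_bounded_above[of "B - A" "\<lambda>u. w (\<pi> u)" 1] w by (simp add: B_def)
    also have "card (B - A) = card B - j"
      using card_Diff_subset[OF fin(1) AB] cA by simp
    finally show ?thesis using False by (simp add: of_nat_diff)
  qed
  then show ?thesis
    by (simp only: A_def B_def sum_of_bool_times[OF finite_atMost] sum_of_bool_card[OF finite_atMost])
qed

section \<open>Value and number of candidates under the quota\<close>

text \<open>From here on times are counted from 0, so that time \<open>t\<close> ends a prefix of length \<open>t + 1\<close>.\<close>

definition quota :: "nat \<Rightarrow> nat \<Rightarrow> nat \<Rightarrow> nat" where
  "quota K n t = K * Suc t div n"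

text \<open>Rounding \<open>\<mu>\<close> down loses at most 1 and at most \<open>\<mu>\<close>,
  hence at most \<open>sqrt \<mu>\<close> whether or not \<open>\<mu> \<le> 1\<close>. The rounding
  error thus gets the same bound as the random deviation.\<close>

lemma quota_bounds:
  assumes "K \<le> n" "t < n"
  shows "quota K n t \<le> Suc t"
    and "real (quota K n t) \<le> K * (real t + 1) / n"
    and "K * (real t + 1) / n - real (quota K n t) \<le> sqrt (K * (real t + 1) / n)"
proof -
  define \<mu> where "\<mu> = K * (real t + 1) / n"
  have \<mu>: "\<mu> = real (K * Suc t) / real n" by (simp add: \<mu>_def algebra_simps)
  show "quota K n t \<le> Suc t"
    unfolding quota_def using div_le_mono[OF mult_le_mono1[OF assms(1)], of "Suc t" n] assms(2)
    by (simp del: mult_Suc_right)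
  show "real (quota K n t) \<le> K * (real t + 1) / n"
    unfolding quota_def \<mu>_def[symmetric] \<mu> by (rule of_nat_div_le_of_nat)
  have "n > 0" using assms(2) by simp
  then have "K * Suc t \<le> n + quota K n t * n"
    unfolding quota_def using dividend_less_div_times[of n "K * Suc t"] by linarith
  then have "real (K * Suc t) \<le> real (n + quota K n t * n)" by (simp only: of_nat_le_iff)
  then have "\<mu> - quota K n t \<le> 1"
    using \<open>n > 0\<close> unfolding \<mu> by (simp add: field_simps)
  show "K * (real t + 1) / n - real (quota K n t) \<le> sqrt (K * (real t + 1) / n)"
    unfolding \<mu>_def[symmetric]
  proof (cases "\<mu> \<le> 1")
    case True
    have "0 \<le> \<mu>" by (simp add: \<mu>_def)
    then have "\<mu> \<le> sqrt \<mu>"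
      using True by (intro real_le_rsqrt) (simp add: power2_eq_square mult_left_le)
    then show "\<mu> - real (quota K n t) \<le> sqrt \<mu>" by linarith
  next
    case False
    then have "1 \<le> sqrt \<mu>" by simp
    then show "\<mu> - real (quota K n t) \<le> sqrt \<mu>"
      using \<open>\<mu> - quota K n t \<le> 1\<close> by linarith
  qed
qed

text \<open>After multiplication by \<open>t + 1\<close>, the last arrival becomes a sum over the
  prefix, which \<open>sum_low_ranks_ge\<close> compares with the benchmark. Of the two square
  roots, one bounds the random deviation and one the rounding of the quota.\<close>

lemma perm_avg_candidate_value:
  fixes w :: "nat \<Rightarrow> real"
  assumes "0 < K" "K \<le> n" "t < n" and w: "\<And>i. i < n \<Longrightarrow> 0 \<le> w i \<and> w i \<le> 1"
  shows "(\<Sum>i<K. w i) / n - 2 * sqrt (K * (real t + 1) / n) / (real t + 1)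
    \<le> perm_avg n (\<lambda>\<pi>. of_bool (prefix_rank \<pi> t t < quota K n t) * w (\<pi> t))"
proof -
  define \<mu> where "\<mu> = K * (real t + 1) / n"
  let ?j = "quota K n t"
  let ?N = "\<lambda>\<pi>. \<Sum>u\<le>t. of_bool (\<pi> u < K) :: real"
  note q = quota_bounds[OF assms(2,3), folded \<mu>_def]
  have point: "perm_avg n (\<lambda>\<pi>. of_bool (\<pi> u < K) * h (\<pi> u)) = (\<Sum>i<K. h i) / n"
    if "u \<le> t" for u and h :: "nat \<Rightarrow> real"
  proof -
    have "(\<Sum>i<n. of_bool (i < K) * h i) = sum h {i\<in>{..<n}. i < K}"
      by (rule sum_of_bool_times) simp
    also have "{i\<in>{..<n}. i < K} = {..<K}" using assms by auto
    finally show ?thesis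
      using perm_avg_point[of u n "\<lambda>i. of_bool (i < K) * h i"] that assms by simp
  qed
  have "\<mu> > 0"
    unfolding \<mu>_def using assms by (intro divide_pos_pos mult_pos_pos) auto
  moreover have "(\<Sum>u\<le>t. K / n) = \<mu>"
    by (simp add: \<mu>_def algebra_simps)
  ultimately have m: "(\<Sum>u\<le>t. K / n) \<le> \<mu>" "\<mu> > 0" by simp_all
  have "perm_avg n (\<lambda>\<pi>. max 0 (?N \<pi> - \<mu>)) \<le> sqrt \<mu>"
  proof (rule perm_avg_excess[where p = "\<lambda>_. K / n"])
    show "perm_avg n (\<lambda>\<pi>. of_bool (\<pi> u < K)) = K / n" if "u \<in> {..t}" for u
      using point[of u "\<lambda>_. 1"] that by simp
    show "perm_avg n (\<lambda>\<pi>. of_bool (\<pi> u < K) * of_bool (\<pi> u' < K)) \<le> K / n * (K / n)"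
      if "u \<in> {..t}" "u' \<in> {..t}" "u \<noteq> u'" for u u'
      using that assms by (intro perm_avg_pair) auto
  qed (rule finite_atMost, fact m(1), fact m(2))
  moreover have "perm_avg n (\<lambda>\<pi>. max 0 (?N \<pi> - ?j)) \<le> perm_avg n (\<lambda>\<pi>. max 0 (?N \<pi> - \<mu>) + (\<mu> - ?j))"
    using q(2) by (intro perm_avg_mono) auto
  ultimately have excess: "perm_avg n (\<lambda>\<pi>. max 0 (?N \<pi> - ?j)) \<le> 2 * sqrt \<mu>"
    using q(3) by (simp add: perm_avg_add perm_avg_const)
  have "(real t + 1) * ((\<Sum>i<K. w i) / n) - 2 * sqrt \<mu>
      \<le> (\<Sum>u\<le>t. perm_avg n (\<lambda>\<pi>. of_bool (\<pi> u < K) * w (\<pi> u)))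
         - perm_avg n (\<lambda>\<pi>. max 0 (?N \<pi> - ?j))"
    using excess by (simp add: point add.commute)
  also have "\<dots> = perm_avg n (\<lambda>\<pi>. (\<Sum>u\<le>t. of_bool (\<pi> u < K) * w (\<pi> u)) - max 0 (?N \<pi> - ?j))"
    by (simp only: perm_avg_sum perm_avg_diff)
  also have "\<dots> \<le> perm_avg n (\<lambda>\<pi>. \<Sum>u\<le>t. of_bool (prefix_rank \<pi> t u < ?j) * w (\<pi> u))"
  proof (intro perm_avg_mono sum_low_ranks_ge)
    fix \<pi> :: "nat \<Rightarrow> nat" and u assume "\<pi> permutes {..<n}" "u \<le> t"
    then show "0 \<le> w (\<pi> u) \<and> w (\<pi> u) \<le> 1"
      using permutes_in_image[of \<pi> "{..<n}" u] assms(3) by (intro w) auto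
  qed (erule permutes_inj, rule q(1))
  \<comment> \<open>Rewriting each \<open>u\<close> as the last arrival after an exchange prepares
    \<open>perm_avg_prefix\<close>.\<close>
  also have "\<dots> = perm_avg n (\<lambda>\<pi>. \<Sum>u\<le>t.
      of_bool (prefix_rank (\<pi> \<circ> Transposition.transpose t u) t t < ?j)
        * w ((\<pi> \<circ> Transposition.transpose t u) t))"
    by (intro perm_avg_cong sum.cong) (simp_all add: prefix_rank_compose permutes_swap_id)
  also have "\<dots> = (real t + 1) * perm_avg n (\<lambda>\<pi>. of_bool (prefix_rank \<pi> t t < ?j) * w (\<pi> t))"
    by (subst (2) perm_avg_prefix[OF assms(3)]) simp
  finally show ?thesis unfolding \<mu>_def[symmetric] by (simp add: field_simps)
qed

lemma perm_avg_candidate_excess: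
  assumes "0 < K" "K \<le> n"
  shows "perm_avg n (\<lambda>\<pi>. max 0 ((\<Sum>t<n. of_bool (prefix_rank \<pi> t t < quota K n t)) - real K))
    \<le> sqrt K"
proof (rule perm_avg_excess[where p = "\<lambda>t. quota K n t / (real t + 1)"])
  let ?a = "\<lambda>t \<pi>. of_bool (prefix_rank \<pi> t t < quota K n t) :: real"
  have q: "min (quota K n t) (Suc t) = quota K n t" if "t < n" for t
    using quota_bounds(1)[OF assms(2) that] by simp
  show mean: "perm_avg n (?a t) = quota K n t / (real t + 1)" if "t \<in> {..<n}" for t
    using perm_avg_prefix_rank[of t n "\<lambda>_. 1" "quota K n t"] that
    by (simp add: q perm_avg_const)
  \<comment> \<open>The earlier time is averaged out first: permuting the first \<open>s + 1\<close>
    arrivals does not affect the rank at the later time \<open>t\<close>, so the probability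
    factorizes.\<close>
  have less: "perm_avg n (\<lambda>\<pi>. ?a s \<pi> * ?a t \<pi>)
      = quota K n s / (real s + 1) * (quota K n t / (real t + 1))" if "s < t" "t < n" for s t
  proof -
    have "perm_avg n (\<lambda>\<pi>. ?a s \<pi> * ?a t \<pi>)
        = real (min (quota K n s) (Suc s)) / (real s + 1) * perm_avg n (?a t)"
    proof (rule perm_avg_prefix_rank)
      fix \<pi> :: "nat \<Rightarrow> nat" and u assume "u \<le> s"
      then have "prefix_rank (\<pi> \<circ> Transposition.transpose s u) t t = prefix_rank \<pi> t t"
        using that(1) by (simp add: prefix_rank_compose permutes_swap_id)
      then show "?a t (\<pi> \<circ> Transposition.transpose s u) = ?a t \<pi>" by simp
    qed (use that in simp)
    then show ?thesis using that by (simp add: q mean)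
  qed
  show "perm_avg n (\<lambda>\<pi>. ?a s \<pi> * ?a t \<pi>)
      \<le> quota K n s / (real s + 1) * (quota K n t / (real t + 1))"
    if "s \<in> {..<n}" "t \<in> {..<n}" "s \<noteq> t" for s t
    using less[of s t] less[of t s] that by (cases s t rule: linorder_cases) (simp_all add: mult.commute)
  have "(\<Sum>t<n. quota K n t / (real t + 1)) \<le> (\<Sum>t<n. K / n)"
    using quota_bounds(2)[OF assms(2)] by (intro sum_mono) (simp add: field_simps)
  then show "(\<Sum>t<n. quota K n t / (real t + 1)) \<le> real K"
    using assms by simp
qed (use assms(1) in simp_all)

section \<open>Selecting the first \<open>K\<close> candidates\<close>

lemma sum_inverse_sqrt_le: "(\<Sum>t<n. 1 / sqrt (real t + 1)) \<le> 2 * sqrt n"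
proof (induction n)
  case (Suc n)
  define a b where "a = sqrt n" and "b = sqrt (real n + 1)"
  have ab: "a * a = n" "b * b = real n + 1" "b > 0" by (auto simp: a_def b_def)
  have "2 * a * b \<le> a * a + b * b"
    \<comment> \<open>Since \<open>b * b = a * a + 1\<close>, this amounts to the telescoping bound
      \<open>1 / b \<le> 2 * (b - a)\<close>.\<close>
    using sum_squares_bound[of a b] by (simp add: power2_eq_square)
  then have "2 * a + 1 / b \<le> 2 * b" using ab by (simp add: field_simps)
  then show ?case using Suc by (simp add: a_def b_def add.commute)
qed simp

text \<open>Counting earlier candidates instead of earlier selections avoids a recursion: while
  there are fewer than \<open>K\<close> of them, all have been selected.\<close>

definition rank_selection :: "nat \<Rightarrow> nat \<Rightarrow> (nat \<Rightarrow> nat) \<Rightarrow> nat set" where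
  "rank_selection K n \<pi> = {t\<in>{..<n}. prefix_rank \<pi> t t < quota K n t
     \<and> card {s. s < t \<and> prefix_rank \<pi> s s < quota K n s} < K}"

text \<open>The number of earlier candidates is the rank of \<open>t\<close> among all candidates
  ordered by time.\<close>

lemma card_first_candidates:
  fixes P :: "nat \<Rightarrow> bool"
  shows "card {t\<in>{..<n}. P t \<and> card {s. s < t \<and> P s} < K} = min K (card {t\<in>{..<n}. P t})"
proof -
  have "below (<) {t\<in>{..<n}. P t} t = {s. s < t \<and> P s}" if "t < n" for t
    using that by (auto simp: below_def)
  then have "{t\<in>{..<n}. P t \<and> card {s. s < t \<and> P s} < K}
      = {t\<in>{t\<in>{..<n}. P t}. card (below (<) {t\<in>{..<n}. P t} t) < K}"
    by auto
  moreover have "card {t\<in>{t\<in>{..<n}. P t}. card (below (<) {t\<in>{..<n}. P t} t) < K}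
      = min K (card {t\<in>{..<n}. P t})"
    by (rule card_low_rank) auto
  ultimately show ?thesis by simp
qed

text \<open>The errors at the single times add up to at most \<open>4 * sqrt K\<close>. The cap
  drops candidates worth at most 1 each, which costs another \<open>sqrt K\<close> on
  average.\<close>

lemma rank_selection_value:
  fixes w :: "nat \<Rightarrow> real"
  assumes "0 < K" "K \<le> n" and w: "\<And>i. i < n \<Longrightarrow> 0 \<le> w i \<and> w i \<le> 1"
  shows "(\<Sum>i<K. w i) - 5 * sqrt K \<le> perm_avg n (\<lambda>\<pi>. \<Sum>t\<in>rank_selection K n \<pi>. w (\<pi> t))"
proof -
  let ?P = "\<lambda>\<pi> t. prefix_rank \<pi> t t < quota K n t"
  have "(\<Sum>t<n. 2 * sqrt (K * (real t + 1) / n) / (real t + 1))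
      = (\<Sum>t<n. 2 * sqrt (K / n) * (1 / sqrt (real t + 1)))"
  proof (intro sum.cong refl)
    fix t
    define r where "r = sqrt (real t + 1)"
    have r: "real t + 1 = r * r" "r > 0" by (simp_all add: r_def)
    have "sqrt (K * (real t + 1) / n) = sqrt (K / n) * r"
      by (simp add: r_def real_sqrt_mult real_sqrt_divide)
    then show "2 * sqrt (K * (real t + 1) / n) / (real t + 1) = 2 * sqrt (K / n) * (1 / sqrt (real t + 1))"
      unfolding r_def[symmetric] using r by simp
  qed
  also have "\<dots> = 2 * sqrt (K / n) * (\<Sum>t<n. 1 / sqrt (real t + 1))"
    by (simp only: sum_distrib_left)
  also have "\<dots> \<le> 2 * sqrt (K / n) * (2 * sqrt n)"
    by (intro mult_left_mono sum_inverse_sqrt_le) simp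
  also have "\<dots> = 4 * sqrt K" using assms by (simp add: real_sqrt_divide)
  finally have err: "(\<Sum>t<n. 2 * sqrt (K * (real t + 1) / n) / (real t + 1)) \<le> 4 * sqrt K" .
  have "(\<Sum>i<K. w i) - 4 * sqrt K
      \<le> (\<Sum>t<n. (\<Sum>i<K. w i) / n - 2 * sqrt (K * (real t + 1) / n) / (real t + 1))"
    using err assms by (simp add: sum_subtractf)
  also have "\<dots> \<le> (\<Sum>t<n. perm_avg n (\<lambda>\<pi>. of_bool (?P \<pi> t) * w (\<pi> t)))"
    using assms by (intro sum_mono perm_avg_candidate_value) auto
  finally have "(\<Sum>i<K. w i) - 4 * sqrt K - sqrt K
      \<le> (\<Sum>t<n. perm_avg n (\<lambda>\<pi>. of_bool (?P \<pi> t) * w (\<pi> t)))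
        - perm_avg n (\<lambda>\<pi>. max 0 ((\<Sum>t<n. of_bool (?P \<pi> t)) - real K))"
    using perm_avg_candidate_excess[OF assms(1,2)] by linarith
  also have "\<dots> = perm_avg n (\<lambda>\<pi>. (\<Sum>t<n. of_bool (?P \<pi> t) * w (\<pi> t))
      - max 0 ((\<Sum>t<n. of_bool (?P \<pi> t)) - real K))"
    by (simp only: perm_avg_sum perm_avg_diff)
  also have "\<dots> \<le> perm_avg n (\<lambda>\<pi>. \<Sum>t\<in>rank_selection K n \<pi>. w (\<pi> t))"
  proof (rule perm_avg_mono)
    fix \<pi> :: "nat \<Rightarrow> nat" assume \<pi>: "\<pi> permutes {..<n}"
    define A where "A = {t\<in>{..<n}. ?P \<pi> t}"
    define S where "S = rank_selection K n \<pi>"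
    have SA: "S \<subseteq> A" and fin: "finite A" "finite S"
      by (auto simp: S_def A_def rank_selection_def)
    have cS: "card S = min K (card A)"
      unfolding S_def A_def rank_selection_def by (rule card_first_candidates)
    have "w (\<pi> t) \<le> 1" if "t \<in> A - S" for t
      using that permutes_in_image[OF \<pi>, of t] w[of "\<pi> t"] by (auto simp: A_def)
    then have "(\<Sum>t\<in>A - S. w (\<pi> t)) \<le> real (card (A - S))"
      using sum_bounded_above[of "A - S" "\<lambda>t. w (\<pi> t)" 1] by simp
    also have "\<dots> = max 0 (real (card A) - real K)"
      using card_Diff_subset[OF fin(2) SA] cS by (simp add: min_def max_def of_nat_diff)
    finally have "(\<Sum>t\<in>A. w (\<pi> t)) - max 0 (real (card A) - real K) \<le> (\<Sum>t\<in>S. w (\<pi> t))"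
      using sum.subset_diff[OF SA fin(1), of "\<lambda>t. w (\<pi> t)"] by simp
    then show "(\<Sum>t<n. of_bool (?P \<pi> t) * w (\<pi> t)) - max 0 ((\<Sum>t<n. of_bool (?P \<pi> t)) - real K)
        \<le> (\<Sum>t\<in>rank_selection K n \<pi>. w (\<pi> t))"
      by (simp only: A_def S_def sum_of_bool_times[OF finite_lessThan] sum_of_bool_card[OF finite_lessThan])
  qed
  finally show ?thesis by simp
qed

subsection \<open>The online algorithm\<close>

text \<open>The labels \<open>\<tau>\<close> are indexed by arrival time, the only index an online
  policy can see; the smaller label wins a tie.\<close>

definition beats :: "(nat \<Rightarrow> nat) \<Rightarrow> real list \<Rightarrow> nat \<Rightarrow> nat \<Rightarrow> bool" where
  "beats \<tau> xs s t \<longleftrightarrow> xs ! t < xs ! s \<or> xs ! s = xs ! t \<and> \<tau> s < \<tau> t"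

text \<open>Truncated subtraction treats the empty history like one of length 1;
  \<open>selected\<close> consults only nonempty prefixes.\<close>

definition candidate :: "nat \<Rightarrow> nat \<Rightarrow> (nat \<Rightarrow> nat) \<Rightarrow> policy" where
  "candidate K n \<tau> xs \<longleftrightarrow>
     card {s. s < length xs - 1 \<and> beats \<tau> xs s (length xs - 1)} < quota K n (length xs - 1)"

definition secretary_policy :: "nat \<Rightarrow> nat \<Rightarrow> (nat \<Rightarrow> nat) \<Rightarrow> policy" where
  "secretary_policy K n \<tau> xs \<longleftrightarrow> candidate K n \<tau> xs
     \<and> card {s. s < length xs - 1 \<and> candidate K n \<tau> (take (Suc s) xs)} < K"

lemma candidate_take:
  assumes "t < length xs"
  shows "candidate K n \<tau> (take (Suc t) xs) \<longleftrightarrow> card {s. s < t \<and> beats \<tau> xs s t} < quota K n t"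
proof -
  have "length (take (Suc t) xs) - 1 = t" using assms by simp
  moreover have "beats \<tau> (take (Suc t) xs) s t \<longleftrightarrow> beats \<tau> xs s t" if "s < t" for s
    using that assms by (simp add: beats_def)
  ultimately show ?thesis unfolding candidate_def by (simp cong: conj_cong)
qed

lemma selected_secretary_policy:
  "selected (secretary_policy K n \<tau>) xs = {t\<in>{..<length xs}. candidate K n \<tau> (take (Suc t) xs)
     \<and> card {s. s < t \<and> candidate K n \<tau> (take (Suc s) xs)} < K}"
proof -
  have "{s. s < length (take (Suc t) xs) - 1 \<and> candidate K n \<tau> (take (Suc s) (take (Suc t) xs))}
      = {s. s < t \<and> candidate K n \<tau> (take (Suc s) xs)}" if "t < length xs" for t
    using that by (auto simp: min_def)
  then show ?thesis unfolding selected_def secretary_policy_def by auto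
qed

lemma feasible_secretary_policy: "K \<le> k \<Longrightarrow> feasible k n (secretary_policy K n \<tau>)"
  unfolding feasible_def selected_secretary_policy card_first_candidates by auto

text \<open>Distinct labels make \<open>beats\<close> a strict linear order even if values repeat.
  Its ranks translate an instance into the permutation setting above.\<close>

lemma obtain_rank_permutation:
  assumes "length v = n" "inj \<tau>"
  obtains \<rho> where "\<rho> permutes {..<n}"
    and "\<And>a b. a < n \<Longrightarrow> b < n \<Longrightarrow> \<rho> a < \<rho> b \<longleftrightarrow> beats \<tau> v a b"
proof
  let ?r = "\<lambda>a. card (below (beats \<tau> v) {..<n} a)"
  \<comment> \<open>Extending by the identity outside \<open>{..<n}\<close> is what
    \<open>permutes\<close> demands.\<close>
  define \<rho> where "\<rho> = (\<lambda>a. if a < n then ?r a else a)"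
  have tot: "beats \<tau> v a b \<or> beats \<tau> v b a" if "a \<noteq> b" for a b
    using injD[OF assms(2), of a b] that unfolding beats_def by linarith
  have irr: "\<not> beats \<tau> v a a" for a by (simp add: beats_def)
  have tr: "beats \<tau> v a c" if "beats \<tau> v a b" "beats \<tau> v b c" for a b c
    using that unfolding beats_def by auto
  have "bij_betw ?r {..<n} {..<card {..<n}}"
    by (rule bij_betw_card_below(1)) (use tot irr tr in blast)+
  moreover have "bij_betw \<rho> {..<n} {..<n} \<longleftrightarrow> bij_betw ?r {..<n} {..<n}"
    by (rule bij_betw_cong) (simp add: \<rho>_def)
  ultimately have "bij_betw \<rho> {..<n} {..<n}" by simp
  then show "\<rho> permutes {..<n}"
    by (rule bij_imp_permutes) (simp add: \<rho>_def)
  show "\<rho> a < \<rho> b \<longleftrightarrow> beats \<tau> v a b" if "a < n" "b < n" for a b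
  proof -
    have "?r a < ?r b \<longleftrightarrow> beats \<tau> v a b"
      by (rule bij_betw_card_below(2)) (use tot irr tr that in blast)+
    then show ?thesis using that by (simp add: \<rho>_def)
  qed
qed

text \<open>The arrival at time \<open>t\<close> is item \<open>\<sigma> t\<close> with label
  \<open>\<tau> (\<sigma> t)\<close>, so comparing arrivals means comparing items under the fixed
  ranking \<open>\<rho>\<close>.\<close>

lemma selected_eq_rank_selection:
  assumes n: "length v = n" and \<sigma>: "\<sigma> permutes {..<n}"
    and \<rho>: "\<And>a b. a < n \<Longrightarrow> b < n \<Longrightarrow> \<rho> a < \<rho> b \<longleftrightarrow> beats \<tau> v a b"
  shows "selected (secretary_policy K n (\<tau> \<circ> \<sigma>)) (permute_list \<sigma> v) = rank_selection K n (\<rho> \<circ> \<sigma>)"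
proof -
  have \<sigma>n: "\<sigma> s < n" if "s < n" for s
    using permutes_in_image[OF \<sigma>, of s] that by simp
  have "candidate K n (\<tau> \<circ> \<sigma>) (take (Suc t) (permute_list \<sigma> v))
      \<longleftrightarrow> prefix_rank (\<rho> \<circ> \<sigma>) t t < quota K n t" if "t < n" for t
  proof -
    have "beats (\<tau> \<circ> \<sigma>) (permute_list \<sigma> v) s t \<longleftrightarrow> (\<rho> \<circ> \<sigma>) s < (\<rho> \<circ> \<sigma>) t" if "s < n" for s
      using \<rho>[OF \<sigma>n \<sigma>n] that \<open>t < n\<close> \<sigma> n by (simp add: beats_def permute_list_nth)
    then have "{s. s < t \<and> beats (\<tau> \<circ> \<sigma>) (permute_list \<sigma> v) s t}
        = below (\<lambda>x y. (\<rho> \<circ> \<sigma>) x < (\<rho> \<circ> \<sigma>) y) {..t} t"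
      using that by (auto simp: below_def le_less)
    then show ?thesis
      using that n by (simp add: candidate_take prefix_rank_def)
  qed
  then show ?thesis
    unfolding selected_secretary_policy rank_selection_def using n
    by (auto intro!: arg_cong2[where f = "(<)"] arg_cong[where f = card]
        simp: less_trans[of _ _ n] cong: conj_cong)
qed

lemma take_upt_min: "take k [0..<n] = [0..<min k n]"
  by (cases "k \<le> n") (simp_all add: take_upt)

text \<open>Listing the items by increasing \<open>\<rho>\<close> sorts \<open>v\<close> in
  decreasing order, whichever way ties are broken.\<close>

lemma top_sum_eq_sum_ranked:
  assumes n: "length v = n" and \<rho>: "\<rho> permutes {..<n}"
    "\<And>a b. a < n \<Longrightarrow> b < n \<Longrightarrow> \<rho> a < \<rho> b \<longleftrightarrow> beats \<tau> v a b"
  shows "top_sum k v = (\<Sum>i<min k n. v ! inv \<rho> i)"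
proof -
  let ?ys = "permute_list (inv \<rho>) v"
  have inv: "inv \<rho> permutes {..<n}" by (rule permutes_inv[OF \<rho>(1)])
  have "sorted (rev ?ys)"
    unfolding sorted_rev_iff_nth_mono
  proof (intro allI impI, rule ccontr)
    fix i j assume ij: "i \<le> j" "j < length ?ys" "\<not> ?ys ! j \<le> ?ys ! i"
    then have lt: "inv \<rho> i < n" "inv \<rho> j < n"
      using permutes_in_image[OF inv] n by auto
    have "beats \<tau> v (inv \<rho> j) (inv \<rho> i)"
      using ij inv n by (simp add: beats_def permute_list_nth)
    then have "\<rho> (inv \<rho> j) < \<rho> (inv \<rho> i)" using \<rho>(2) lt by simp
    then show False using ij(1) by (simp add: permutes_inverses(1)[OF \<rho>(1)])
  qed
  moreover have "mset (rev ?ys) = mset v" using inv n by simp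
  ultimately have "sort v = rev ?ys" by (intro properties_for_sort)
  then have "take k (rev (sort v)) = map (\<lambda>i. v ! inv \<rho> i) [0..<min k n]"
    by (simp add: permute_list_def n take_map take_upt_min)
  then show ?thesis
    by (simp add: top_sum_def interv_sum_list_conv_sum_set_nat lessThan_atLeast0)
qed

text \<open>The target space consists of the feasible policies only, with every subset measurable,
  so feasibility is built into the space. The cap \<open>min k n\<close> keeps each quota within the
  length of its prefix.\<close>

definition secretary_algorithm :: "nat \<Rightarrow> nat \<Rightarrow> policy measure" where
  "secretary_algorithm k n = distr (measure_pmf (pmf_of_set {\<tau>. \<tau> permutes {..<n}}))
     (count_space {d. feasible k n d}) (secretary_policy (min k n) n)"

lemma secretary_policy_measurable:
  "secretary_policy (min k n) n
     \<in> measurable (measure_pmf p) (count_space {d. feasible k n d})"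
  by (simp add: feasible_secretary_policy)

lemma online_secretary_algorithm: "online_algorithm k n (secretary_algorithm k n)"
  unfolding online_algorithm_def secretary_algorithm_def
proof (intro conjI allI)
  show "prob_space (distr (measure_pmf (pmf_of_set {\<tau>. \<tau> permutes {..<n}}))
     (count_space {d. feasible k n d}) (secretary_policy (min k n) n))"
    by (intro prob_space.prob_space_distr prob_space_measure_pmf secretary_policy_measurable)
next
  fix h
  show "(\<lambda>d. d h) \<in> measurable (distr (measure_pmf (pmf_of_set {\<tau>. \<tau> permutes {..<n}}))
     (count_space {d. feasible k n d}) (secretary_policy (min k n) n)) (count_space UNIV)"
    unfolding measurable_distr_eq1 by (rule measurable_count_space)
qed (simp only: space_distr space_count_space mem_Collect_eq Ball_def simp_thms)

lemma integral_permutations: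
  "measure_pmf.expectation (pmf_of_set {\<sigma>. \<sigma> permutes {..<n}}) f = perm_avg n f"
proof -
  have "{\<sigma>. \<sigma> permutes {..<n}} \<noteq> {}" using permutes_id by blast
  then show ?thesis
    by (simp add: integral_pmf_of_set finite_permutations card_permutations perm_avg_def)
qed

lemma perm_avg_commute:
  "perm_avg n (\<lambda>\<sigma>. perm_avg n (f \<sigma>)) = perm_avg n (\<lambda>\<tau>. perm_avg n (\<lambda>\<sigma>. f \<sigma> \<tau>))"
  unfolding perm_avg_def sum_divide_distrib by (rule sum.swap)

text \<open>
  Substituting \<open>\<tau> \<circ> \<sigma>\<close> for \<open>\<tau>\<close> attaches the tie-breaking labels to the items instead of the
  arrival times, which fixes a strict ranking of the items before the arrival order is drawn.
\<close>

lemma expected_gain_secretary_algorithm: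
  assumes "length v = n"
  shows "expected_gain (secretary_algorithm k n) v = perm_avg n (\<lambda>\<tau>. perm_avg n
    (\<lambda>\<sigma>. gain (secretary_policy (min k n) n (\<tau> \<circ> \<sigma>)) (permute_list \<sigma> v)))"
proof -
  let ?g = "\<lambda>\<sigma> \<tau>. gain (secretary_policy (min k n) n \<tau>) (permute_list \<sigma> v)"
  have "(LINT d|secretary_algorithm k n. gain d (permute_list \<sigma> v)) = perm_avg n (?g \<sigma>)" for \<sigma>
    unfolding secretary_algorithm_def
    by (subst integral_distr[OF secretary_policy_measurable]) (simp_all add: integral_permutations)
  then have "expected_gain (secretary_algorithm k n) v = perm_avg n (\<lambda>\<sigma>. perm_avg n (?g \<sigma>))"
    by (simp add: expected_gain_def assms integral_permutations)
  also have "\<dots> = perm_avg n (\<lambda>\<sigma>. perm_avg n (\<lambda>\<tau>. ?g \<sigma> (\<tau> \<circ> \<sigma>)))"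
  proof (rule perm_avg_cong)
    fix \<sigma> :: "nat \<Rightarrow> nat" assume "\<sigma> permutes {..<n}"
    then show "perm_avg n (?g \<sigma>) = perm_avg n (\<lambda>\<tau>. ?g \<sigma> (\<tau> \<circ> \<sigma>))"
      using perm_avg_compose_right[of \<sigma> n "?g \<sigma>"] by (simp only:)
  qed
  also have "\<dots> = perm_avg n (\<lambda>\<tau>. perm_avg n (\<lambda>\<sigma>. ?g \<sigma> (\<tau> \<circ> \<sigma>)))"
    by (rule perm_avg_commute)
  finally show ?thesis .
qed

lemma regret_secretary_algorithm:
  assumes "v \<in> instances n" "1 \<le> k"
  shows "regret k (secretary_algorithm k n) v \<le> 5 * sqrt k"
proof (cases "n = 0")
  \<comment> \<open>The rank analysis assumes \<open>0 < K\<close>, so the instance without arrivals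
    is treated directly.\<close>
  case True
  then have "v = []" using assms by (simp add: instances_def)
  then show ?thesis
    by (simp add: regret_def top_sum_def expected_gain_def gain_def selected_def)
next
  case False
  define K where "K = min k n"
  have K: "0 < K" "K \<le> n" "K \<le> k" using False assms by (auto simp: K_def)
  have n: "length v = n" using assms by (simp add: instances_def)
  have v01: "0 \<le> v ! i \<and> v ! i \<le> 1" if "i < n" for i
  proof -
    have "v ! i \<in> {0..1}"
      using assms(1) nth_mem[of i v] that n unfolding instances_def by blast
    then show ?thesis by simp
  qed
  \<comment> \<open>The bound is shown for each fixed labelling of the items, where only the arrival
    order is random; the labels are averaged at the end.\<close>
  have "top_sum k v - 5 * sqrt K
      \<le> perm_avg n (\<lambda>\<sigma>. gain (secretary_policy K n (\<tau> \<circ> \<sigma>)) (permute_list \<sigma> v))"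
    if \<tau>: "\<tau> permutes {..<n}" for \<tau>
  proof -
    obtain \<rho> where \<rho>: "\<rho> permutes {..<n}"
      "\<And>a b. a < n \<Longrightarrow> b < n \<Longrightarrow> \<rho> a < \<rho> b \<longleftrightarrow> beats \<tau> v a b"
      using obtain_rank_permutation[OF n permutes_inj[OF \<tau>]] by blast
    define w where "w = (\<lambda>i. v ! inv \<rho> i)"
    have w: "0 \<le> w i \<and> w i \<le> 1" if "i < n" for i
      unfolding w_def using permutes_in_image[OF permutes_inv[OF \<rho>(1)], of i] that by (intro v01) simp
    have "top_sum k v - 5 * sqrt K = (\<Sum>i<K. w i) - 5 * sqrt K"
      by (simp add: top_sum_eq_sum_ranked[OF n \<rho>] K_def w_def)
    also have "\<dots> \<le> perm_avg n (\<lambda>\<pi>. \<Sum>t\<in>rank_selection K n \<pi>. w (\<pi> t))"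
      by (rule rank_selection_value[OF K(1,2) w])
    \<comment> \<open>For uniform \<open>\<sigma>\<close>, the sequence of overall ranks
      \<open>\<rho> \<circ> \<sigma>\<close> is uniform as well.\<close>
    also have "\<dots> = perm_avg n (\<lambda>\<sigma>. \<Sum>t\<in>rank_selection K n (\<rho> \<circ> \<sigma>). w ((\<rho> \<circ> \<sigma>) t))"
      by (rule perm_avg_compose_left[OF \<rho>(1), symmetric])
    also have "\<dots> = perm_avg n (\<lambda>\<sigma>. gain (secretary_policy K n (\<tau> \<circ> \<sigma>)) (permute_list \<sigma> v))"
    proof (rule perm_avg_cong)
      fix \<sigma> :: "nat \<Rightarrow> nat" assume \<sigma>: "\<sigma> permutes {..<n}"
      have "selected (secretary_policy K n (\<tau> \<circ> \<sigma>)) (permute_list \<sigma> v) = rank_selection K n (\<rho> \<circ> \<sigma>)"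
        by (rule selected_eq_rank_selection[OF n \<sigma>]) (rule \<rho>(2))
      then show "(\<Sum>t\<in>rank_selection K n (\<rho> \<circ> \<sigma>). w ((\<rho> \<circ> \<sigma>) t))
          = gain (secretary_policy K n (\<tau> \<circ> \<sigma>)) (permute_list \<sigma> v)"
        unfolding gain_def using \<sigma> n by (intro sum.cong)
          (auto simp: rank_selection_def w_def permute_list_nth permutes_inverses(2)[OF \<rho>(1)])
    qed
    finally show ?thesis .
  qed
  then have "perm_avg n (\<lambda>\<tau>. top_sum k v - 5 * sqrt K) \<le> expected_gain (secretary_algorithm k n) v"
    unfolding expected_gain_secretary_algorithm[OF n] K_def[symmetric] by (rule perm_avg_mono)
  moreover have "sqrt K \<le> sqrt k" using K(3) by simp
  ultimately show ?thesis
    unfolding regret_def perm_avg_const by linarith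
qed

theorem theoremA1:
  "\<exists>A :: nat \<Rightarrow> nat \<Rightarrow> policy measure.
     (\<forall>k\<ge>1. \<forall>n. online_algorithm k n (A k n)) \<and>
     (\<exists>C::real. \<forall>k\<ge>1. worst_case_regret k (A k) \<le> ereal (C * sqrt (real k)))"
proof (intro exI conjI allI impI)
  show "online_algorithm k n (secretary_algorithm k n)" for k n
    by (rule online_secretary_algorithm)
  show "worst_case_regret k (secretary_algorithm k) \<le> ereal (5 * sqrt (real k))" if "1 \<le> k" for k
    unfolding worst_case_regret_def
    by (intro SUP_least) (use regret_secretary_algorithm that in simp)
qed

end
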